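(* Let $V$ be a nonempty doubled word, $q\geq 2$ an integer, and $W_n\in[q]^n$ chosen uniformly at random. Then, as $n\to\infty$, $$\mathrm{Var}(\delta(V,W_n))=O\left(\mathbb{E}(\delta(V,W_n))^2\,\frac{(\log n)^3}{n}\right).$$
   Context: A word is doubled if every letter occurring in it occurs at least twice. $[q]=\{1,\dots,q\}$ and $[q]^n$ is the set of words of length $n$ over $[q]$. A word $U$ is an instance of $V$ (a $V$-instance) if $U=\phi(V)$ for some homomorphism $\phi$ of free monoids that is nonerasing (no letter is mapped to the empty word). For a word $W$ and $0\le i<j\le|W|$, $W[i,j]$ is the factor consisting of the $j-i$ consecutive letters of $W$ beginning with the $(i+1)$-th. The density of $V$ in $W$ is $$\delta(V,W)=\frac{|\{(i,j):0\le i<j\le|W|,\ W[i,j]\text{ is a }V\text{-instance}\}|}{\binom{|W|+1}{2}}.$$ The implied constant may depend on $V$ and $q$. *)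

theory Defs
  imports "HOL-Probability.Probability" "HOL-Library.Landau_Symbols"
begin

definition doubled :: "'a list \<Rightarrow> bool" where
  "doubled V \<longleftrightarrow> (\<forall>x\<in>set V. 2 \<le> count_list V x)"

text \<open>Lists over a type form the free monoid on that type. Preservation of the unit,
  \<open>\<phi> [] = []\<close>, follows from the first conjunct by cancellation.\<close>

definition nonerasing_hom :: "('a list \<Rightarrow> 'b list) \<Rightarrow> bool" where
  "nonerasing_hom \<phi> \<longleftrightarrow>
     (\<forall>xs ys. \<phi> (xs @ ys) = \<phi> xs @ \<phi> ys) \<and> (\<forall>x. \<phi> [x] \<noteq> [])"

definition is_instance :: "'a list \<Rightarrow> 'b list \<Rightarrow> bool" where
  "is_instance V U \<longleftrightarrow> (\<exists>\<phi>. nonerasing_hom \<phi> \<and> U = \<phi> V)"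

definition factor :: "'b list \<Rightarrow> nat \<Rightarrow> nat \<Rightarrow> 'b list" where
  "factor W i j = take (j - i) (drop i W)"

definition instance_density :: "'a list \<Rightarrow> 'b list \<Rightarrow> real" where
  "instance_density V W =
     real (card {(i, j). i < j \<and> j \<le> length W \<and> is_instance V (factor W i j)})
       / real ((length W + 1) choose 2)"

definition words :: "nat \<Rightarrow> nat \<Rightarrow> nat list set" where
  "words q n = {W. set W \<subseteq> {1..q} \<and> length W = n}"

definition random_word :: "nat \<Rightarrow> nat \<Rightarrow> nat list pmf" where
  "random_word q n = pmf_of_set (words q n)"

end

theory Submission
  imports Defs
begin

text \<open>
  Let \<open>X\<close> be the number of pairs \<open>(i, j)\<close> for which \<open>W\<^sub>n[i, j]\<close> is an instance of \<open>V\<close>. The density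
  is \<open>X\<close> divided by a constant of order \<open>n\<^sup>2\<close>, so the expectation and the variance of \<open>X\<close> are to be
  compared. The variance is at most, and the expectation at least, of order \<open>n\<close>. For the variance the
  reason is that instances of a doubled word are short.

  In an instance of length \<open>m\<close> of a doubled word the images of the distinct letters have total
  length at most \<open>m / 2\<close>, as each of them is used twice. The instance is therefore determined by a
  word of length \<open>m div 2\<close> in which all these images occur, together with their positions, and for
  these there are only polynomially many choices. Hence a random word of length \<open>m\<close> is an instance
  with a probability \<open>p\<^sub>m\<close> that is at most a polynomial in \<open>m\<close> times \<open>(1 / sqrt q)\<^sup>m\<close>
  (lemma \<open>instance_prob_le\<close>), and \<open>\<Sum>m. m\<^sup>2 * p\<^sub>m\<close> converges.

  The variance of \<open>X\<close> is the sum of the covariances of the events attached to two intervals. Disjoint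
  intervals carry independent factors of \<open>W\<^sub>n\<close> and contribute nothing. The covariance of two
  overlapping intervals is at most the probability of the event of the longer one. An interval of
  length \<open>m\<close> overlaps at most \<open>6 * m\<^sup>2\<close> intervals that are not longer, and there are at most \<open>n\<close>
  intervals of length \<open>m\<close>, so the variance is at most \<open>12 * n * (\<Sum>m. m\<^sup>2 * p\<^sub>m)\<close>
  (lemma \<open>variance_instance_count_le\<close>).

  The factors of length \<open>|V|\<close> alone make the expectation of \<open>X\<close> at least
  \<open>(n + 1 - |V|) / q ^ |V|\<close> (lemma \<open>expectation_instance_count_ge\<close>), since \<open>11\<dots>1\<close> is an
  instance of this length. The variance of \<open>X\<close> is thus \<open>O(E(X)\<^sup>2 / n)\<close>, and dividing by the square of the
  normalizing constant turns this into a bound for the density; finally \<open>ln n \<ge> 1\<close> for \<open>n \<ge> 3\<close>.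
\<close>

section \<open>Instances of a doubled word are rare\<close>

text \<open>A homomorphism of free monoids is the same as a choice of images for the letters, which is the
  form in which instances can be counted.\<close>

lemma is_instance_iff_concat_map:
  "is_instance V U \<longleftrightarrow> (\<exists>f. (\<forall>x. f x \<noteq> []) \<and> U = concat (map f V))"
proof
  assume "is_instance V U"
  then obtain \<phi> where app: "\<And>xs ys. \<phi> (xs @ ys) = \<phi> xs @ \<phi> ys"
    and ne: "\<And>x. \<phi> [x] \<noteq> []" and U: "U = \<phi> V"
    unfolding is_instance_def nonerasing_hom_def by blast
  have "\<phi> xs = concat (map (\<lambda>x. \<phi> [x]) xs)" for xs
  proof (induction xs)
    case Nil
    have "\<phi> [] = \<phi> [] @ \<phi> []" using app[of "[]" "[]"] by (simp only: append_Nil)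
    then show ?case by (metis append_self_conv concat.simps(1) list.map(1))
  next
    case (Cons x xs)
    have "\<phi> (x # xs) = \<phi> [x] @ \<phi> xs" using app[of "[x]" xs] by (simp only: append_Cons append_Nil)
    then show ?case using Cons by (simp only: list.map concat.simps)
  qed
  then show "\<exists>f. (\<forall>x. f x \<noteq> []) \<and> U = concat (map f V)"
    using ne U by metis
next
  assume "\<exists>f. (\<forall>x. f x \<noteq> []) \<and> U = concat (map f V)"
  then obtain f where "\<forall>x. f x \<noteq> []" "U = concat (map f V)" by blast
  then show "is_instance V U"
    unfolding is_instance_def nonerasing_hom_def
    by (intro exI[of _ "\<lambda>xs. concat (map f xs)"]) auto
qed

lemma finite_words [simp]: "finite (words q n)"
  unfolding words_def by (rule finite_lists_length_eq) simp

lemma card_words: "card (words q n) = q ^ n"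
  unfolding words_def by (subst card_lists_length_eq) auto

lemma replicate_1_in_words: "q \<ge> 1 \<Longrightarrow> replicate n 1 \<in> words q n"
  by (auto simp: words_def)

lemma words_nonempty: "q \<ge> 1 \<Longrightarrow> words q n \<noteq> {}"
  using replicate_1_in_words by blast

lemma length_concat_map_sum:
  "length (concat (map f V)) = (\<Sum>x\<in>set V. count_list V x * length (f x))"
  by (simp add: length_concat comp_def sum_list_map_eq_sum_count)

lemma length_concat_map_remdups:
  "length (concat (map f (remdups V))) = (\<Sum>x\<in>set V. length (f x))"
  by (simp add: length_concat comp_def sum_list_distinct_conv_sum_set)

text \<open>The images of the distinct letters of \<open>V\<close>, written one after the other, form a word \<open>w0\<close> with
  \<open>2 * |w0| \<le> |U|\<close>, since each letter of \<open>V\<close> is used at least twice. So \<open>U\<close> can be rebuilt from a word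
  of half its length and the end points \<open>e x\<close> of a place where the image of \<open>x\<close> occurs in it.\<close>

lemma doubled_instance_from_half:
  assumes "doubled V" "q \<ge> 1" "U \<in> words q m" "is_instance V U"
  obtains w e where "w \<in> words q (m div 2)" "e \<in> set V \<rightarrow>\<^sub>E {..m} \<times> {..m}"
    "U = concat (map (\<lambda>x. factor w (fst (e x)) (snd (e x))) V)"
proof -
  obtain f where U: "U = concat (map f V)"
    using assms(4) by (auto simp: is_instance_iff_concat_map)
  define w0 where "w0 = concat (map f (remdups V))"
  \<comment> \<open>Padding by the letter 1 makes the length depend on \<open>m\<close> only.\<close>
  define w where "w = w0 @ replicate (m div 2 - length w0) 1"
  have "2 * length w0 = (\<Sum>x\<in>set V. 2 * length (f x))"
    by (simp add: w0_def length_concat_map_remdups sum_distrib_left)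
  also have "\<dots> \<le> (\<Sum>x\<in>set V. count_list V x * length (f x))"
    using assms(1) by (intro sum_mono mult_right_mono) (auto simp: doubled_def)
  also have "\<dots> = m"
    using assms(3) unfolding U by (simp only: words_def mem_Collect_eq length_concat_map_sum)
  finally have len: "length w0 \<le> m div 2" by simp
  have "set w0 = set U" by (auto simp: w0_def U)
  then have w: "w \<in> words q (m div 2)"
    using len assms(2,3) by (auto simp: w_def words_def)
  have "\<exists>ab. ab \<in> {..m} \<times> {..m} \<and> factor w (fst ab) (snd ab) = f x" if x: "x \<in> set V" for x
  proof -
    obtain ys zs where s: "remdups V = ys @ x # zs"
      using x by (metis set_remdups split_list)
    let ?a = "length (concat (map f ys))"
    have "factor w ?a (?a + length (f x)) = f x"
      by (simp add: w_def w0_def s factor_def)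
    moreover have "?a + length (f x) \<le> m"
      using len by (simp add: w0_def s)
    ultimately show ?thesis
      by (intro exI[of _ "(?a, ?a + length (f x))"]) simp
  qed
  then obtain e where e: "\<And>x. x \<in> set V \<Longrightarrow>
      e x \<in> {..m} \<times> {..m} \<and> factor w (fst (e x)) (snd (e x)) = f x"
    by metis
  show thesis
  proof
    show "restrict e (set V) \<in> set V \<rightarrow>\<^sub>E {..m} \<times> {..m}" using e by auto
    show "U = concat (map (\<lambda>x. factor w (fst (restrict e (set V) x)) (snd (restrict e (set V) x))) V)"
      unfolding U using e by (intro arg_cong[where f = concat] map_cong) auto
  qed (fact w)
qed

lemma card_doubled_instances_le:
  assumes "doubled V" "q \<ge> 1"
  shows "card {U \<in> words q m. is_instance V U} \<le> q ^ (m div 2) * (m + 1) ^ (2 * card (set V))"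
proof -
  let ?E = "set V \<rightarrow>\<^sub>E {..m} \<times> {..m}"
  let ?dec = "\<lambda>(w, e). concat (map (\<lambda>x. factor w (fst (e x)) (snd (e x))) V)"
  have finE: "finite ?E" by (intro finite_PiE) auto
  have "{U \<in> words q m. is_instance V U} \<subseteq> ?dec ` (words q (m div 2) \<times> ?E)"
  proof
    fix U assume "U \<in> {U \<in> words q m. is_instance V U}"
    then obtain w e where "w \<in> words q (m div 2)" "e \<in> ?E" "U = ?dec (w, e)"
      using doubled_instance_from_half[OF assms, of U m] by auto
    then show "U \<in> ?dec ` (words q (m div 2) \<times> ?E)" by blast
  qed
  then have "card {U \<in> words q m. is_instance V U} \<le> card (?dec ` (words q (m div 2) \<times> ?E))"
    using finE by (intro card_mono finite_imageI finite_cartesian_product) auto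
  also have "\<dots> \<le> card (words q (m div 2) \<times> ?E)"
    using finE by (intro card_image_le finite_cartesian_product) auto
  also have "\<dots> = q ^ (m div 2) * (m + 1) ^ (2 * card (set V))"
    by (simp add: card_cartesian_product card_words card_PiE power_mult power2_eq_square)
  finally show ?thesis .
qed

text \<open>This is also the probability that a given factor of length \<open>m\<close> of a longer random word is an
  instance of \<open>V\<close>; see \<open>prob_factor_instance\<close> below.\<close>

definition instance_prob :: "'a list \<Rightarrow> nat \<Rightarrow> nat \<Rightarrow> real" where
  "instance_prob V q m = measure_pmf.prob (random_word q m) {U. is_instance V U}"

lemma instance_prob_eq_card:
  assumes "q \<ge> 1"
  shows "instance_prob V q m = real (card {U \<in> words q m. is_instance V U}) / real q ^ m"
  using assms unfolding instance_prob_def random_word_def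
  by (subst measure_pmf_of_set) (auto simp: words_nonempty card_words Collect_conj_eq)

lemma instance_prob_nonneg: "instance_prob V q m \<ge> 0"
  by (simp add: instance_prob_def)

text \<open>Of the \<open>q ^ m\<close> words at most a polynomial multiple of \<open>q ^ (m div 2)\<close> are instances. Writing
  \<open>q ^ (m div 2)\<close> as a power of \<open>sqrt q\<close> avoids a distinction by the parity of \<open>m\<close>.\<close>

lemma instance_prob_le:
  assumes "doubled V" "q \<ge> 1"
  shows "instance_prob V q m \<le> real (m + 1) ^ (2 * card (set V)) * (1 / sqrt (real q)) ^ m"
proof -
  have s: "sqrt (real q) \<ge> 1" using assms(2) by simp
  have "instance_prob V q m \<le> real (q ^ (m div 2) * (m + 1) ^ (2 * card (set V))) / real q ^ m"
    unfolding instance_prob_eq_card[OF assms(2)]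
    by (intro divide_right_mono of_nat_mono card_doubled_instances_le assms) auto
  also have "\<dots> = real (m + 1) ^ (2 * card (set V)) * (real q ^ (m div 2) / real q ^ m)"
    by simp
  also have "real q ^ (m div 2) = sqrt (real q) ^ (2 * (m div 2))"
    by (simp add: power_mult)
  also have "real q ^ m = sqrt (real q) ^ m * sqrt (real q) ^ m"
    by (simp flip: power_mult_distrib)
  also have "sqrt (real q) ^ (2 * (m div 2)) / (sqrt (real q) ^ m * sqrt (real q) ^ m)
      \<le> sqrt (real q) ^ m / (sqrt (real q) ^ m * sqrt (real q) ^ m)"
    using s by (intro divide_right_mono power_increasing) auto
  also have "\<dots> = (1 / sqrt (real q)) ^ m"
    using s by (simp add: power_divide)
  finally show ?thesis by (simp add: mult_left_mono)
qed

text \<open>Sending every letter to the letter 1 gives an instance of length \<open>|V|\<close>, whatever the size of the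
  alphabet of \<open>V\<close>.\<close>

lemma instance_prob_length_ge:
  assumes "q \<ge> 1"
  shows "instance_prob V q (length V) \<ge> 1 / real q ^ length V"
proof -
  have "concat (map (\<lambda>_. [1::nat]) V) = replicate (length V) 1"
    by (induction V) auto
  then have "is_instance V (replicate (length V) (1::nat))"
    unfolding is_instance_iff_concat_map by (intro exI[of _ "\<lambda>_. [1]"]) auto
  then have "{replicate (length V) 1} \<subseteq> {U \<in> words q (length V). is_instance V U}"
    using replicate_1_in_words[OF assms] by auto
  then have "card {replicate (length V) (1::nat)} \<le> card {U \<in> words q (length V). is_instance V U}"
    by (intro card_mono) auto
  then show ?thesis
    unfolding instance_prob_eq_card[OF assms] by (intro divide_right_mono) auto
qed

lemma summable_power_mult_geometric:
  fixes r :: real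
  assumes "0 < r" "r < 1"
  shows "summable (\<lambda>m. real (m + 1) ^ K * r ^ m)"
proof -
  let ?f = "\<lambda>m. real (m + 1) ^ K * r ^ m"
  have "(\<lambda>m. (1 + inverse (real (Suc m))) ^ K * r) \<longlonglongrightarrow> 1 ^ K * r"
    by (intro tendsto_intros LIMSEQ_inverse_real_of_nat_add)
  then have "\<forall>\<^sub>F m in sequentially. (1 + inverse (real (Suc m))) ^ K * r < (1 + r) / 2"
    using assms by (intro order_tendstoD) auto
  then obtain N where N: "\<And>m. m \<ge> N \<Longrightarrow> (1 + inverse (real (Suc m))) ^ K * r < (1 + r) / 2"
    unfolding eventually_sequentially by blast
  show ?thesis
  proof (rule summable_ratio_test)
    fix m assume "m \<ge> N"
    have "real (Suc m + 1) = (1 + inverse (real (Suc m))) * real (m + 1)"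
      by (simp add: field_simps)
    then have "?f (Suc m) = ((1 + inverse (real (Suc m))) ^ K * r) * ?f m"
      by (simp only: power_mult_distrib power_Suc mult_ac)
    also have "\<dots> \<le> (1 + r) / 2 * ?f m"
      using N[OF \<open>m \<ge> N\<close>] assms by (intro mult_right_mono) auto
    finally show "norm (?f (Suc m)) \<le> (1 + r) / 2 * norm (?f m)"
      using assms by simp
  qed (use assms in simp)
qed

text \<open>The weight \<open>m\<^sup>2\<close> is the order of the number of intervals that overlap a given interval of
  length \<open>m\<close> and are not longer.\<close>

lemma summable_square_mult_instance_prob:
  assumes "doubled V" "q \<ge> 2"
  shows "summable (\<lambda>m. real m ^ 2 * instance_prob V q m)"
proof (rule summable_comparison_test'[where N = 0])
  let ?k = "2 * card (set V)"
  show "summable (\<lambda>m. real (m + 1) ^ (2 + ?k) * (1 / sqrt (real q)) ^ m)"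
    using assms by (intro summable_power_mult_geometric) auto
  fix m :: nat
  have "real m ^ 2 * instance_prob V q m
      \<le> real (m + 1) ^ 2 * (real (m + 1) ^ ?k * (1 / sqrt (real q)) ^ m)"
    using assms by (intro mult_mono instance_prob_le power_mono) (auto simp: instance_prob_nonneg)
  also have "\<dots> = real (m + 1) ^ (2 + ?k) * (1 / sqrt (real q)) ^ m"
    by (simp only: power_add mult.assoc)
  finally show "norm (real m ^ 2 * instance_prob V q m)
      \<le> real (m + 1) ^ (2 + ?k) * (1 / sqrt (real q)) ^ m"
    by (simp add: instance_prob_nonneg)
qed

section \<open>Factors of a random word\<close>

lemma set_pmf_random_word: "q \<ge> 1 \<Longrightarrow> set_pmf (random_word q n) = words q n"
  by (simp add: random_word_def words_nonempty)

lemma random_word_append: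
  assumes "q \<ge> 1"
  shows "random_word q (a + b) = map_pmf (\<lambda>(u, v). u @ v) (pair_pmf (random_word q a) (random_word q b))"
proof -
  have "pair_pmf (random_word q a) (random_word q b) = pmf_of_set (words q a \<times> words q b)"
    using assms by (intro pmf_eqI)
      (auto simp: random_word_def pmf_pair words_nonempty indicator_def)
  moreover have "bij_betw (\<lambda>(u, v). u @ v) (words q a \<times> words q b) (words q (a + b))"
  proof (rule bij_betw_byWitness[where f' = "\<lambda>W. (take a W, drop a W)"])
    show "(\<lambda>W. (take a W, drop a W)) ` words q (a + b) \<subseteq> words q a \<times> words q b"
      by (auto simp: words_def dest: in_set_takeD in_set_dropD)
  qed (auto simp: words_def subset_eq)
  ultimately show ?thesis
    using assms by (simp add: random_word_def map_pmf_of_set_bij_betw words_nonempty)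
qed

lemma map_pmf_take_drop_random_word:
  assumes "q \<ge> 1" "a \<le> n"
  shows "map_pmf (\<lambda>W. (take a W, drop a W)) (random_word q n)
    = pair_pmf (random_word q a) (random_word q (n - a))"
proof -
  let ?P = "pair_pmf (random_word q a) (random_word q (n - a))"
  have "map_pmf (\<lambda>W. (take a W, drop a W)) (random_word q n)
      = map_pmf (\<lambda>(u, v). (take a (u @ v), drop a (u @ v))) ?P"
    using random_word_append[OF assms(1), of a "n - a"] assms(2)
    by (simp add: pmf.map_comp comp_def case_prod_unfold)
  also have "\<dots> = map_pmf (\<lambda>x. x) ?P"
    using assms(1)
    by (intro map_pmf_cong) (auto simp: set_pmf_random_word words_def)
  finally show ?thesis by simp
qed

lemma map_pmf_take_random_word:
  assumes "q \<ge> 1" "a \<le> n"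
  shows "map_pmf (take a) (random_word q n) = random_word q a"
  using arg_cong[OF map_pmf_take_drop_random_word[OF assms], of "map_pmf fst"]
  by (simp add: pmf.map_comp comp_def map_fst_pair_pmf)

lemma map_pmf_drop_random_word:
  assumes "q \<ge> 1" "a \<le> n"
  shows "map_pmf (drop a) (random_word q n) = random_word q (n - a)"
  using arg_cong[OF map_pmf_take_drop_random_word[OF assms], of "map_pmf snd"]
  by (simp add: pmf.map_comp comp_def map_snd_pair_pmf)

lemma map_pmf_factor_random_word:
  assumes "q \<ge> 1" "i \<le> j" "j \<le> n"
  shows "map_pmf (\<lambda>W. factor W i j) (random_word q n) = random_word q (j - i)"
proof -
  have "map_pmf (\<lambda>W. factor W i j) (random_word q n)
      = map_pmf (take (j - i)) (map_pmf (drop i) (random_word q n))"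
    by (simp add: factor_def pmf.map_comp comp_def)
  also have "\<dots> = random_word q (j - i)"
    using assms by (simp add: map_pmf_drop_random_word map_pmf_take_random_word)
  finally show ?thesis .
qed

text \<open>Cutting the word at \<open>j\<close> puts the two factors into its two parts, and these are independent.\<close>

lemma map_pmf_disjoint_factors_random_word:
  assumes "q \<ge> 1" "i \<le> j" "j \<le> i'" "i' \<le> j'" "j' \<le> n"
  shows "map_pmf (\<lambda>W. (factor W i j, factor W i' j')) (random_word q n)
    = pair_pmf (random_word q (j - i)) (random_word q (j' - i'))"
proof -
  have *: "factor W i j = factor (take j W) i j" "factor W i' j' = factor (drop j W) (i' - j) (j' - j)" for W :: "nat list"
    using assms by (auto simp: factor_def drop_take)
  have "map_pmf (\<lambda>W. (factor W i j, factor W i' j')) (random_word q n)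
     = map_pmf (\<lambda>(u, v). (factor u i j, factor v (i' - j) (j' - j)))
        (map_pmf (\<lambda>W. (take j W, drop j W)) (random_word q n))"
    unfolding pmf.map_comp by (intro map_pmf_cong refl) (simp flip: *)
  also have "\<dots> = pair_pmf (random_word q (j - i)) (random_word q ((j' - j) - (i' - j)))"
    using assms by (simp add: map_pmf_take_drop_random_word map_pair map_pmf_factor_random_word)
  also have "(j' - j) - (i' - j) = j' - i'" using assms by simp
  finally show ?thesis .
qed

lemma prob_factor_instance:
  assumes "q \<ge> 1" "i \<le> j" "j \<le> n"
  shows "measure_pmf.prob (random_word q n) {W. is_instance V (factor W i j)}
    = instance_prob V q (j - i)"
  unfolding instance_prob_def map_pmf_factor_random_word[OF assms, symmetric] measure_map_pmf
  by (simp add: vimage_def)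

lemma prob_disjoint_factors_instances:
  assumes "q \<ge> 1" "i \<le> j" "j \<le> i'" "i' \<le> j'" "j' \<le> n"
  shows "measure_pmf.prob (random_word q n)
      ({W. is_instance V (factor W i j)} \<inter> {W. is_instance V (factor W i' j')})
    = instance_prob V q (j - i) * instance_prob V q (j' - i')"
proof -
  have "measure_pmf.prob (random_word q n)
      ({W. is_instance V (factor W i j)} \<inter> {W. is_instance V (factor W i' j')})
    = measure_pmf.prob (map_pmf (\<lambda>W. (factor W i j, factor W i' j')) (random_word q n))
      ({U. is_instance V U} \<times> {U. is_instance V U})"
    unfolding measure_map_pmf by (intro arg_cong2[where f = measure]) auto
  also have "\<dots> = instance_prob V q (j - i) * instance_prob V q (j' - i')"
    unfolding map_pmf_disjoint_factors_random_word[OF assms] instance_prob_def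
    by (rule measure_pmf_prob_product) auto
  finally show ?thesis .
qed

section \<open>The variance of a number of locally dependent events\<close>

text \<open>Only pairs related by \<open>D\<close> can have a nonzero covariance, and \<open>P(A I \<inter> A J)\<close> is at most the
  probability of either event. The function \<open>len\<close> decides which of the two is taken: each pair is
  charged to its longer member. For factors of a word this is the choice that makes the sum small,
  since the probabilities decay exponentially in the length. The factor 2 accounts for the two
  orders of a pair.\<close>

lemma variance_count_le:
  fixes M :: "'w pmf" and A :: "'i \<Rightarrow> 'w set" and len :: "'i \<Rightarrow> nat"
  assumes fin: "finite S"
    and sym: "\<And>I J. D I J \<Longrightarrow> D J I"
    and indep: "\<And>I J. I \<in> S \<Longrightarrow> J \<in> S \<Longrightarrow> \<not> D I J \<Longrightarrow>
      measure_pmf.prob M (A I \<inter> A J) = measure_pmf.prob M (A I) * measure_pmf.prob M (A J)"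
  shows "measure_pmf.variance M (\<lambda>w. \<Sum>I\<in>S. indicator (A I) w)
    \<le> 2 * (\<Sum>I\<in>S. real (card {J \<in> S. D I J \<and> len J \<le> len I}) * measure_pmf.prob M (A I))"
proof -
  let ?P = "measure_pmf.prob M"
  let ?X = "\<lambda>w. \<Sum>I\<in>S. indicator (A I) w :: real"
  define g where "g I J = (if D I J \<and> len J \<le> len I then ?P (A I) else 0)" for I J
  have int: "integrable M (indicator B :: 'w \<Rightarrow> real)" for B
    by (intro measure_pmf.integrable_const_bound[where B = 1]) auto
  have sq: "(?X w)\<^sup>2 = (\<Sum>I\<in>S. \<Sum>J\<in>S. indicator (A I \<inter> A J) w)" for w
    by (simp add: power2_eq_square sum_product indicator_inter_arith)
  have "measure_pmf.variance M ?X
      = measure_pmf.expectation M (\<lambda>w. (?X w)\<^sup>2) - (measure_pmf.expectation M ?X)\<^sup>2"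
    by (rule measure_pmf.variance_eq) (unfold sq, auto intro!: Bochner_Integration.integrable_sum int)
  also have "measure_pmf.expectation M (\<lambda>w. (?X w)\<^sup>2) = (\<Sum>I\<in>S. \<Sum>J\<in>S. ?P (A I \<inter> A J))"
    unfolding sq by (simp add: Bochner_Integration.integral_sum int)
  also have "(measure_pmf.expectation M ?X)\<^sup>2 = (\<Sum>I\<in>S. \<Sum>J\<in>S. ?P (A I) * ?P (A J))"
    by (simp add: Bochner_Integration.integral_sum int power2_eq_square sum_product)
  also have "(\<Sum>I\<in>S. \<Sum>J\<in>S. ?P (A I \<inter> A J)) - (\<Sum>I\<in>S. \<Sum>J\<in>S. ?P (A I) * ?P (A J))
      = (\<Sum>I\<in>S. \<Sum>J\<in>S. ?P (A I \<inter> A J) - ?P (A I) * ?P (A J))"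
    by (simp add: sum_subtractf)
  also have "\<dots> \<le> (\<Sum>I\<in>S. \<Sum>J\<in>S. g I J + g J I)"
  proof (intro sum_mono)
    fix I J assume IJ: "I \<in> S" "J \<in> S"
    have nn: "g I J \<ge> 0" "g J I \<ge> 0" by (auto simp: g_def)
    show "?P (A I \<inter> A J) - ?P (A I) * ?P (A J) \<le> g I J + g J I"
    proof (cases "D I J")
      case False
      then show ?thesis using indep[OF IJ] nn by simp
    next
      case True
      have "?P (A I \<inter> A J) \<le> ?P (A I)" "?P (A I \<inter> A J) \<le> ?P (A J)"
        by (auto intro!: measure_pmf.finite_measure_mono)
      moreover have "0 \<le> ?P (A I) * ?P (A J)" by simp
      moreover have "?P (A I) \<le> g I J \<or> ?P (A J) \<le> g J I"
        using True sym[OF True] by (auto simp: g_def)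
      ultimately show ?thesis using nn by linarith
    qed
  qed
  also have "\<dots> = 2 * (\<Sum>I\<in>S. \<Sum>J\<in>S. g I J)"
  proof -
    have "(\<Sum>I\<in>S. \<Sum>J\<in>S. g J I) = (\<Sum>I\<in>S. \<Sum>J\<in>S. g I J)" by (rule sum.swap)
    then show ?thesis by (simp add: sum.distrib)
  qed
  also have "(\<Sum>I\<in>S. \<Sum>J\<in>S. g I J)
      = (\<Sum>I\<in>S. real (card {J \<in> S. D I J \<and> len J \<le> len I}) * ?P (A I))"
    using fin by (simp add: g_def sum.If_cases Int_def)
  finally show ?thesis .
qed

section \<open>Mean and variance of the number of instances\<close>

definition intervals :: "nat \<Rightarrow> (nat \<times> nat) set" where
  "intervals n = {(i, j). i < j \<and> j \<le> n}"

text \<open>The intervals range up to the parameter \<open>n\<close> and not up to the length of \<open>W\<close>, which makes the count a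
  sum of indicators over a fixed index set.\<close>

definition instance_count :: "'a list \<Rightarrow> nat \<Rightarrow> 'b list \<Rightarrow> real" where
  "instance_count V n W = (\<Sum>I\<in>intervals n. indicator {W. is_instance V (factor W (fst I) (snd I))} W)"

lemma finite_intervals [simp]: "finite (intervals n)"
  by (rule finite_subset[of _ "{..n} \<times> {..n}"]) (auto simp: intervals_def)

lemma instance_density_eq:
  assumes "length W = n"
  shows "instance_density V W = instance_count V n W / real ((n + 1) choose 2)"
proof -
  have "{(i, j). i < j \<and> j \<le> n \<and> is_instance V (factor W i j)}
      = {I \<in> intervals n. is_instance V (factor W (fst I) (snd I))}"
    by (auto simp: intervals_def)
  moreover have "real (card {I \<in> intervals n. is_instance V (factor W (fst I) (snd I))})
      = instance_count V n W"
    by (simp add: instance_count_def indicator_def sum.If_cases Int_def)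
  ultimately show ?thesis
    using assms by (simp add: instance_density_def)
qed

text \<open>With \<open>m = j - i\<close>, such an interval starts in \<open>{i - m..i + m}\<close> and ends in \<open>{i + 1..i + 2 * m}\<close>; these
  sets have at most \<open>3 * m\<close> and \<open>2 * m\<close> elements.\<close>

lemma card_overlapping_shorter_le:
  "card {(i', j') \<in> intervals n. (i < j' \<and> i' < j) \<and> j' - i' \<le> j - i} \<le> 6 * (j - i)\<^sup>2"
proof (cases "i < j")
  case False
  have "{(i', j') \<in> intervals n. (i < j' \<and> i' < j) \<and> j' - i' \<le> j - i} = {}"
    using False by (auto simp: intervals_def)
  then show ?thesis by (simp only: card.empty le0)
next
  case True
  define m where "m = j - i"
  then have m: "m \<ge> 1" "j = i + m" using True by auto
  have "{(i', j') \<in> intervals n. (i < j' \<and> i' < j) \<and> j' - i' \<le> j - i}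
      \<subseteq> {i - m..i + m} \<times> {i + 1..i + 2 * m}"
    using m by (auto simp: intervals_def)
  then have "card {(i', j') \<in> intervals n. (i < j' \<and> i' < j) \<and> j' - i' \<le> j - i}
      \<le> card ({i - m..i + m} \<times> {i + 1..i + 2 * m})"
    by (intro card_mono) auto
  also have "\<dots> \<le> (3 * m) * (2 * m)"
    unfolding card_cartesian_product using m by (intro mult_mono) auto
  finally show ?thesis by (simp add: m_def power2_eq_square)
qed

text \<open>There are at most \<open>n\<close> intervals of any given length, at most one for each left end.\<close>

lemma sum_intervals_le:
  fixes f :: "nat \<Rightarrow> real"
  assumes "summable f" "\<And>m. f m \<ge> 0"
  shows "(\<Sum>(i, j)\<in>intervals n. f (j - i)) \<le> real n * suminf f"
proof -
  have inj: "inj_on (\<lambda>(i, j). (i, j - i)) (intervals n)"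
    by (auto simp: inj_on_def intervals_def)
  have "(\<Sum>(i, j)\<in>intervals n. f (j - i))
      = (\<Sum>(i, m)\<in>(\<lambda>(i, j). (i, j - i)) ` intervals n. f m)"
    by (subst sum.reindex[OF inj]) (simp add: case_prod_beta comp_def)
  also have "\<dots> \<le> (\<Sum>(i, m)\<in>{..<n} \<times> {..n}. f m)"
    using assms by (intro sum_mono2) (auto simp: intervals_def)
  also have "\<dots> = real n * (\<Sum>m\<le>n. f m)"
    by (simp flip: sum.cartesian_product)
  also have "\<dots> \<le> real n * suminf f"
    using assms by (intro mult_left_mono sum_le_suminf) auto
  finally show ?thesis .
qed

lemma variance_instance_count_le:
  assumes "doubled V" "q \<ge> 2"
  shows "measure_pmf.variance (random_word q n) (instance_count V n)
    \<le> 12 * real n * (\<Sum>m. real m ^ 2 * instance_prob V q m)"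
proof -
  let ?M = "random_word q n"
  let ?A = "\<lambda>I. {W. is_instance V (factor W (fst I) (snd I))}"
  let ?D = "\<lambda>I J :: nat \<times> nat. fst I < snd J \<and> fst J < snd I"
  let ?len = "\<lambda>I :: nat \<times> nat. snd I - fst I"
  have P: "measure_pmf.prob ?M (?A I) = instance_prob V q (?len I)" if "I \<in> intervals n" for I
    using that assms by (auto simp: intervals_def prob_factor_instance)
  have "measure_pmf.variance ?M (\<lambda>W. \<Sum>I\<in>intervals n. indicator (?A I) W)
      \<le> 2 * (\<Sum>I\<in>intervals n. real (card {J \<in> intervals n. ?D I J \<and> ?len J \<le> ?len I})
          * measure_pmf.prob ?M (?A I))"
  proof (rule variance_count_le)
    fix I J assume IJ: "I \<in> intervals n" "J \<in> intervals n" "\<not> ?D I J"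
    then consider "snd J \<le> fst I" | "snd I \<le> fst J" by linarith
    then show "measure_pmf.prob ?M (?A I \<inter> ?A J) = measure_pmf.prob ?M (?A I) * measure_pmf.prob ?M (?A J)"
    proof cases
      case 1
      then show ?thesis
        using IJ assms prob_disjoint_factors_instances[of q "fst J" "snd J" "fst I" "snd I" n V]
        by (auto simp: P Int_commute intervals_def mult.commute)
    next
      case 2
      then show ?thesis
        using IJ assms prob_disjoint_factors_instances[of q "fst I" "snd I" "fst J" "snd J" n V]
        by (auto simp: P intervals_def)
    qed
  qed auto
  also have "\<dots> \<le> 2 * (\<Sum>I\<in>intervals n. 6 * (real (?len I) ^ 2 * instance_prob V q (?len I)))"
  proof (intro mult_left_mono sum_mono)
    fix I assume I: "I \<in> intervals n"
    have "{J \<in> intervals n. ?D I J \<and> ?len J \<le> ?len I}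
      = {(i', j') \<in> intervals n. (fst I < j' \<and> i' < snd I) \<and> j' - i' \<le> snd I - fst I}" by auto
    then have "card {J \<in> intervals n. ?D I J \<and> ?len J \<le> ?len I} \<le> 6 * (?len I)\<^sup>2"
      by (simp only: card_overlapping_shorter_le)
    then have "real (card {J \<in> intervals n. ?D I J \<and> ?len J \<le> ?len I}) \<le> 6 * real (?len I) ^ 2"
      using of_nat_mono by fastforce
    then show "real (card {J \<in> intervals n. ?D I J \<and> ?len J \<le> ?len I}) * measure_pmf.prob ?M (?A I)
      \<le> 6 * (real (?len I) ^ 2 * instance_prob V q (?len I))"
      using mult_right_mono[OF _ instance_prob_nonneg] by (simp only: P[OF I] flip: mult.assoc)
  qed auto
  also have "\<dots> = 12 * (\<Sum>(i, j)\<in>intervals n. real (j - i) ^ 2 * instance_prob V q (j - i))"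
    by (simp add: case_prod_beta sum_distrib_left)
  also have "\<dots> \<le> 12 * (real n * (\<Sum>m. real m ^ 2 * instance_prob V q m))"
    using assms by (intro mult_left_mono sum_intervals_le summable_square_mult_instance_prob)
      (auto simp: instance_prob_nonneg)
  finally show ?thesis
    unfolding instance_count_def by (simp add: mult.assoc)
qed

text \<open>It suffices to count the factors of length \<open>|V|\<close>. For \<open>n < |V|\<close> the truncated difference vanishes.\<close>

lemma expectation_instance_count_ge:
  assumes "V \<noteq> []" "q \<ge> 1"
  shows "measure_pmf.expectation (random_word q n) (instance_count V n)
    \<ge> real (n + 1 - length V) / real q ^ length V"
proof -
  let ?M = "random_word q n" and ?l = "length V"
  let ?A = "\<lambda>I. {W. is_instance V (factor W (fst I) (snd I))}"
  have int: "integrable ?M (indicator B :: nat list \<Rightarrow> real)" for B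
    by (intro measure_pmf.integrable_const_bound[where B = 1]) auto
  have "real (n + 1 - ?l) / real q ^ ?l = (\<Sum>i<n + 1 - ?l. 1 / real q ^ ?l)" by simp
  also have "\<dots> \<le> (\<Sum>i<n + 1 - ?l. measure_pmf.prob ?M (?A (i, i + ?l)))"
    using assms by (intro sum_mono) (simp add: prob_factor_instance instance_prob_length_ge)
  also have "\<dots> = (\<Sum>I\<in>(\<lambda>i. (i, i + ?l)) ` {..<n + 1 - ?l}. measure_pmf.prob ?M (?A I))"
    by (subst sum.reindex) (auto simp: inj_on_def)
  also have "\<dots> \<le> (\<Sum>I\<in>intervals n. measure_pmf.prob ?M (?A I))"
    using assms by (intro sum_mono2 finite_intervals) (auto simp: intervals_def)
  also have "\<dots> = measure_pmf.expectation ?M (instance_count V n)"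
    unfolding instance_count_def by (simp add: Bochner_Integration.integral_sum int)
  finally show ?thesis .
qed

text \<open>Every word in the support has length \<open>n\<close>, so there the density is a constant multiple of the
  count.\<close>

lemma
  assumes "q \<ge> 1"
  shows expectation_instance_density_eq:
    "measure_pmf.expectation (random_word q n) (instance_density V)
      = measure_pmf.expectation (random_word q n) (instance_count V n) / real ((n + 1) choose 2)"
      (is "?E = ?E' / ?c")
    and variance_instance_density_eq:
    "measure_pmf.variance (random_word q n) (instance_density V)
      = measure_pmf.variance (random_word q n) (instance_count V n) / (real ((n + 1) choose 2))\<^sup>2"
proof -
  have supp: "AE W in random_word q n. instance_density V W = instance_count V n W / ?c"
    using assms unfolding AE_measure_pmf_iff
    by (intro ballI instance_density_eq) (simp add: set_pmf_random_word words_def)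
  show *: "?E = ?E' / ?c"
    by (subst integral_cong_AE[OF _ _ supp]) auto
  have "measure_pmf.variance (random_word q n) (instance_density V)
      = measure_pmf.expectation (random_word q n) (\<lambda>W. (instance_count V n W - ?E')\<^sup>2 / ?c\<^sup>2)"
    using supp by (intro integral_cong_AE) (auto simp: * power_divide simp flip: diff_divide_distrib)
  then show "measure_pmf.variance (random_word q n) (instance_density V)
      = measure_pmf.variance (random_word q n) (instance_count V n) / ?c\<^sup>2"
    by simp
qed

theorem theorem4p20:
  fixes V :: "'a list" and q :: nat
  assumes "V \<noteq> []" and "doubled V" and "q \<ge> 2"
  shows "(\<lambda>n::nat. measure_pmf.variance (random_word q n) (instance_density V))
           \<in> O(\<lambda>n. (measure_pmf.expectation (random_word q n) (instance_density V))\<^sup>2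
                    * ((ln (real n)) ^ 3 / real n))"
proof -
  let ?E = "\<lambda>n. measure_pmf.expectation (random_word q n) (instance_count V n)"
  let ?V = "\<lambda>n. measure_pmf.variance (random_word q n) (instance_count V n)"
  let ?c = "\<lambda>n. real ((n + 1) choose 2)"
  let ?Q = "real q ^ length V"
  define S where "S = (\<Sum>m. real m ^ 2 * instance_prob V q m)"
  have q: "q \<ge> 1" and Q: "?Q > 0" using assms by auto
  have S: "S \<ge> 0"
    unfolding S_def using assms
    by (intro suminf_nonneg summable_square_mult_instance_prob) (auto simp: instance_prob_nonneg)
  have "?V n \<le> 48 * S * ?Q\<^sup>2 * ((?E n)\<^sup>2 * (ln (real n) ^ 3 / real n))"
    if n: "n \<ge> 2 * length V + 3" for n
  proof -
    \<comment> \<open>\<open>n \<ge> 2 * |V|\<close> turns the lower bound for the expectation into a multiple of \<open>n\<close>.\<close>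
    have "real n / (2 * ?Q) \<le> real (n + 1 - length V) / ?Q"
      using n Q by (simp add: field_simps)
    also have "\<dots> \<le> ?E n" using assms q by (intro expectation_instance_count_ge)
    finally have "(real n / (2 * ?Q))\<^sup>2 \<le> (?E n)\<^sup>2" using Q by (intro power_mono) auto
    then have E: "real n ^ 2 \<le> 4 * ?Q\<^sup>2 * (?E n)\<^sup>2"
      using Q by (simp add: power_divide power_mult_distrib field_simps)
    have "exp 1 \<le> real n" using n exp_le by linarith
    then have "1 \<le> ln (real n)" using n by (subst ln_ge_iff) auto
    then have ln: "1 \<le> ln (real n) ^ 3" by (rule one_le_power)
    have "?V n \<le> 12 * real n * S"
      unfolding S_def using assms by (intro variance_instance_count_le)
    also have "\<dots> = 12 * S * (real n ^ 2 * (1 / real n))"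
      using n by (simp add: power2_eq_square)
    also have "\<dots> \<le> 12 * S * ((4 * ?Q\<^sup>2 * (?E n)\<^sup>2) * (ln (real n) ^ 3 / real n))"
      using S E ln n by (intro mult_left_mono mult_mono divide_right_mono) auto
    finally show ?thesis by (simp add: mult_ac)
  qed
  then have le: "?V n / (?c n)\<^sup>2 \<le> 48 * S * ?Q\<^sup>2 * ((?E n)\<^sup>2 * (ln (real n) ^ 3 / real n)) / (?c n)\<^sup>2"
    if "n \<ge> 2 * length V + 3" for n
    using that by (intro divide_right_mono) auto
  have "norm (?V n / (?c n)\<^sup>2)
      \<le> 48 * S * ?Q\<^sup>2 * norm ((?E n / ?c n)\<^sup>2 * (ln (real n) ^ 3 / real n))"
    if "n \<ge> 2 * length V + 3" for n
  proof -
    have "norm (?V n / (?c n)\<^sup>2) = ?V n / (?c n)\<^sup>2"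
      using measure_pmf.variance_positive by simp
    also have "\<dots> \<le> 48 * S * ?Q\<^sup>2 * ((?E n / ?c n)\<^sup>2 * (ln (real n) ^ 3 / real n))"
      using le[OF that] by (simp only: divide_inverse power_mult_distrib power_inverse mult_ac)
    also have "\<dots> \<le> 48 * S * ?Q\<^sup>2 * norm ((?E n / ?c n)\<^sup>2 * (ln (real n) ^ 3 / real n))"
      unfolding real_norm_def using S by (intro mult_left_mono abs_ge_self) auto
    finally show ?thesis .
  qed
  then show ?thesis
    unfolding variance_instance_density_eq[OF q] unfolding expectation_instance_density_eq[OF q]
    by (intro bigoI[where c = "48 * S * ?Q\<^sup>2"] eventually_sequentiallyI[of "2 * length V + 3"])
qed

end
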